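(* Let $k\le n$ and $m\ge 2$ be positive integers. Then \[ T(mn,k)=\sum_{p=k}^{n}(-1)^{p-k}\binom{p}{k}\,t(\{m\}^p)\,t^{\star}(\{m\}^{n-p}) \] and \[ T^{\star}(mn,k)=\sum_{q=k}^{n}(-1)^{n+q}\binom{q}{k}\,t(\{m\}^{n-q})\,t^{\star}(\{m\}^{q}). \]
   Context: For a $k$-tuple $\boldsymbol{\alpha}=(\alpha_1,\dots,\alpha_k)$ of positive integers (with the series convergent), the multiple $t$-value is $t(\alpha_1,\dots,\alpha_k)=\sum_{1\le j_1<j_2<\cdots<j_k}\prod_{i=1}^k (2j_i-1)^{-\alpha_i}$ and the multiple star $t$-value is $t^{\star}(\alpha_1,\dots,\alpha_k)=\sum_{1\le j_1\le j_2\le\cdots\le j_k}\prod_{i=1}^k (2j_i-1)^{-\alpha_i}$. The weight is $|\boldsymbol{\alpha}|=\alpha_1+\cdots+\alpha_k$. $(\{a\}^n)$ denotes the string $(a,a,\dots,a)$ with $n$ entries, and by convention $t(\{m\}^0)=t^{\star}(\{m\}^0)=1$. For positive integers $k\le n$ and $m\ge 2$, $T(mn,k)=\sum t(m\alpha_1,\dots,m\alpha_k)$ and $T^{\star}(mn,k)=\sum t^{\star}(m\alpha_1,\dots,m\alpha_k)$, where both sums run over all $k$-tuples $(\alpha_1,\dots,\alpha_k)$ of positive integers with $\alpha_1+\cdots+\alpha_k=n$. *)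

theory Defs
  imports "HOL-Analysis.Analysis"
begin

text \<open>
  Tuples are lists; the tuples \<open>(j\<^sub>1, \<dots>, j\<^sub>k)\<close> and \<open>(\<alpha>\<^sub>1, \<dots>, \<alpha>\<^sub>k)\<close> are indexed from 0
  by \<open>!\<close>. The series are unordered sums of nonnegative terms, so they exist exactly when
  the usual multiple series converges (for instance when all exponents are at least 2);
  a divergent series gets the value 0. For the empty tuple the only summand is the empty
  product, so both values are 1.
\<close>

definition mult_t :: "nat list \<Rightarrow> real" where
  "mult_t \<alpha> =
     (\<Sum>\<^sub>\<infinity>j \<in> {j :: nat list. length j = length \<alpha> \<and> (\<forall>x\<in>set j. 1 \<le> x) \<and> sorted_wrt (<) j}.
        \<Prod>i<length \<alpha>. 1 / (2 * real (j ! i) - 1) ^ (\<alpha> ! i))"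

definition mult_t_star :: "nat list \<Rightarrow> real" where
  "mult_t_star \<alpha> =
     (\<Sum>\<^sub>\<infinity>j \<in> {j :: nat list. length j = length \<alpha> \<and> (\<forall>x\<in>set j. 1 \<le> x) \<and> sorted_wrt (\<le>) j}.
        \<Prod>i<length \<alpha>. 1 / (2 * real (j ! i) - 1) ^ (\<alpha> ! i))"

definition pos_tuples :: "nat \<Rightarrow> nat \<Rightarrow> nat list set" where
  "pos_tuples n k = {\<alpha>. length \<alpha> = k \<and> (\<forall>a\<in>set \<alpha>. 1 \<le> a) \<and> sum_list \<alpha> = n}"

text \<open>
  The values \<open>T(mn, k)\<close> and \<open>T\<^sup>\<star>(mn, k)\<close> depend on \<open>m\<close> and \<open>n\<close> separately, not only on
  the product \<open>mn\<close>, hence the three arguments \<open>m\<close>, \<open>n\<close>, \<open>k\<close>.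
\<close>

definition T_sum :: "nat \<Rightarrow> nat \<Rightarrow> nat \<Rightarrow> real" where
  "T_sum m n k = (\<Sum>\<alpha>\<in>pos_tuples n k. mult_t (map (\<lambda>a. m * a) \<alpha>))"

definition T_star_sum :: "nat \<Rightarrow> nat \<Rightarrow> nat \<Rightarrow> real" where
  "T_star_sum m n k = (\<Sum>\<alpha>\<in>pos_tuples n k. mult_t_star (map (\<lambda>a. m * a) \<alpha>))"

end

theory Submission
  imports Defs "HOL-Computational_Algebra.Formal_Power_Series"
begin

text \<open>
  Put \<open>x\<^sub>j = (2j - 1)\<^sup>-\<^sup>m\<close> and let \<open>E(z) = \<Prod>\<^sub>j (1 + x\<^sub>j z)\<close> and \<open>H(z) = \<Prod>\<^sub>j (1 - x\<^sub>j z)\<^sup>-\<^sup>1\<close> be the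
  generating functions of \<open>t({m}\<^sup>p)\<close> and \<open>t\<^sup>\<star>({m}\<^sup>p)\<close>. Grouping equal summation indices gives
  \<open>\<Sum> T(mn,k) y\<^sup>k z\<^sup>n = \<Prod>\<^sub>j (1 + y x\<^sub>j z / (1 - x\<^sub>j z)) = E((y - 1) z) H(z)\<close> and
  \<open>\<Sum> T\<^sup>\<star>(mn,k) y\<^sup>k z\<^sup>n = \<Prod>\<^sub>j (1 - y x\<^sub>j z / (1 - x\<^sub>j z))\<^sup>-\<^sup>1 = E(-z) H((1 + y) z)\<close>;
  compare coefficients of \<open>y\<^sup>k z\<^sup>n\<close>. To stay within formal power series, the products are
  truncated at \<open>j \<le> N\<close>, built up one factor at a time, and \<open>N\<close> tends to infinity at the level of
  coefficients only.
\<close>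

section \<open>Truncated sums\<close>

definition strict_lists :: "nat \<Rightarrow> nat \<Rightarrow> nat list set" where
  "strict_lists N k = {j. length j = k \<and> set j \<subseteq> {1..N} \<and> sorted_wrt (<) j}"

definition weak_lists :: "nat \<Rightarrow> nat \<Rightarrow> nat list set" where
  "weak_lists N k = {j. length j = k \<and> set j \<subseteq> {1..N} \<and> sorted_wrt (\<le>) j}"

definition t_term :: "nat list \<Rightarrow> nat list \<Rightarrow> real" where
  "t_term \<alpha> j = (\<Prod>i<length \<alpha>. 1 / (2 * real (j ! i) - 1) ^ (\<alpha> ! i))"

definition trunc_t :: "nat \<Rightarrow> nat list \<Rightarrow> real" where
  "trunc_t N \<alpha> = sum (t_term \<alpha>) (strict_lists N (length \<alpha>))"

definition trunc_t_star :: "nat \<Rightarrow> nat list \<Rightarrow> real" where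
  "trunc_t_star N \<alpha> = sum (t_term \<alpha>) (weak_lists N (length \<alpha>))"

lemma finite_strict_lists: "finite (strict_lists N k)"
  by (rule finite_subset[OF _ finite_lists_length_eq[of "{1..N}" k]])
    (auto simp: strict_lists_def)

lemma finite_weak_lists: "finite (weak_lists N k)"
  by (rule finite_subset[OF _ finite_lists_length_eq[of "{1..N}" k]])
    (auto simp: weak_lists_def)

lemma strict_lists_Nil: "strict_lists N 0 = {[]}"
  by (auto simp: strict_lists_def)

lemma weak_lists_Nil: "weak_lists N 0 = {[]}"
  by (auto simp: weak_lists_def)

lemma strict_lists_zero: "strict_lists 0 (Suc k) = {}"
  by (auto simp: strict_lists_def)

lemma weak_lists_zero: "weak_lists 0 (Suc k) = {}"
  by (auto simp: weak_lists_def)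

text \<open>The last entry is the largest, so the split is by whether it equals
  \<open>Suc N\<close>; if so, the remaining entries are at most \<open>N\<close>.\<close>

lemma strict_lists_Suc:
  "strict_lists (Suc N) (Suc k) =
     strict_lists N (Suc k) \<union> (\<lambda>j. j @ [Suc N]) ` strict_lists N k"
proof (intro set_eqI iffI)
  fix j assume j: "j \<in> strict_lists (Suc N) (Suc k)"
  then obtain l x where jl: "j = l @ [x]"
    by (cases j rule: rev_cases) (auto simp: strict_lists_def)
  from j jl have l: "length l = k" "sorted_wrt (<) l" "\<forall>y\<in>set l. 1 \<le> y \<and> y < x"
      "1 \<le> x" "x \<le> Suc N"
    by (auto simp: strict_lists_def sorted_wrt_append)
  show "j \<in> strict_lists N (Suc k) \<union> (\<lambda>j. j @ [Suc N]) ` strict_lists N k"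
  proof (cases "x = Suc N")
    case True
    then have "l \<in> strict_lists N k" using l by (force simp: strict_lists_def)
    then show ?thesis using jl True by auto
  next
    case False
    then have "j \<in> strict_lists N (Suc k)"
      using l jl by (force simp: strict_lists_def sorted_wrt_append)
    then show ?thesis by blast
  qed
qed (force simp: strict_lists_def sorted_wrt_append)+

text \<open>In contrast to the strict case, the entries before a final \<open>Suc N\<close> may
  repeat it, so the bound \<open>Suc N\<close> survives in the second part.\<close>

lemma weak_lists_Suc:
  "weak_lists (Suc N) (Suc k) =
     weak_lists N (Suc k) \<union> (\<lambda>j. j @ [Suc N]) ` weak_lists (Suc N) k"
proof (intro set_eqI iffI)
  fix j assume j: "j \<in> weak_lists (Suc N) (Suc k)"
  then obtain l x where jl: "j = l @ [x]"
    by (cases j rule: rev_cases) (auto simp: weak_lists_def)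
  from j jl have l: "length l = k" "sorted_wrt (\<le>) l" "\<forall>y\<in>set l. 1 \<le> y \<and> y \<le> x"
      "1 \<le> x" "x \<le> Suc N"
    by (auto simp: weak_lists_def sorted_wrt_append)
  show "j \<in> weak_lists N (Suc k) \<union> (\<lambda>j. j @ [Suc N]) ` weak_lists (Suc N) k"
  proof (cases "x = Suc N")
    case True
    then have "l \<in> weak_lists (Suc N) k" using l by (force simp: weak_lists_def)
    then show ?thesis using jl True by auto
  next
    case False
    then have "j \<in> weak_lists N (Suc k)"
      using l jl by (force simp: weak_lists_def sorted_wrt_append)
    then show ?thesis by blast
  qed
qed (force simp: weak_lists_def sorted_wrt_append)+

section \<open>Recursions of the truncated values in \<open>N\<close>\<close>

lemma t_term_snoc:
  assumes "length j = length \<alpha>"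
  shows "t_term (\<alpha> @ [a]) (j @ [x]) = t_term \<alpha> j * (1 / (2 * real x - 1)) ^ a"
  using assms by (simp add: t_term_def nth_append power_one_over)

lemma t_term_nonneg:
  assumes "length j = length \<alpha>" "\<forall>x\<in>set j. 1 \<le> x"
  shows "0 \<le> t_term \<alpha> j"
  unfolding t_term_def
proof (rule prod_nonneg)
  fix i assume "i \<in> {..<length \<alpha>}"
  then have "1 \<le> j ! i" using assms by auto
  then show "0 \<le> 1 / (2 * real (j ! i) - 1) ^ (\<alpha> ! i)" by simp
qed

lemma trunc_t_Nil [simp]: "trunc_t N [] = 1"
  by (simp add: trunc_t_def strict_lists_Nil t_term_def)

lemma trunc_t_star_Nil [simp]: "trunc_t_star N [] = 1"
  by (simp add: trunc_t_star_def weak_lists_Nil t_term_def)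

lemma trunc_t_zero: "\<alpha> \<noteq> [] \<Longrightarrow> trunc_t 0 \<alpha> = 0"
  by (cases \<alpha>) (simp_all add: trunc_t_def strict_lists_zero)

lemma trunc_t_star_zero: "\<alpha> \<noteq> [] \<Longrightarrow> trunc_t_star 0 \<alpha> = 0"
  by (cases \<alpha>) (simp_all add: trunc_t_star_def weak_lists_zero)

lemma trunc_t_snoc:
  "trunc_t (Suc N) (\<alpha> @ [a]) = trunc_t N (\<alpha> @ [a]) + (1 / (2 * real N + 1)) ^ a * trunc_t N \<alpha>"
proof -
  let ?A = "strict_lists N (Suc (length \<alpha>))"
  let ?B = "(\<lambda>j. j @ [Suc N]) ` strict_lists N (length \<alpha>)"
  have disj: "?A \<inter> ?B = {}" by (auto simp: strict_lists_def)
  have "sum (t_term (\<alpha> @ [a])) ?B =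
      (\<Sum>j\<in>strict_lists N (length \<alpha>). t_term (\<alpha> @ [a]) (j @ [Suc N]))"
    by (subst sum.reindex) (auto simp: inj_on_def)
  also have "\<dots> = (\<Sum>j\<in>strict_lists N (length \<alpha>). (1 / (2 * real N + 1)) ^ a * t_term \<alpha> j)"
    by (rule sum.cong) (auto simp: strict_lists_def t_term_snoc algebra_simps)
  finally show ?thesis
    using sum.union_disjoint[OF finite_strict_lists finite_imageI[OF finite_strict_lists] disj,
        of "t_term (\<alpha> @ [a])"]
    by (simp add: trunc_t_def strict_lists_Suc sum_distrib_left)
qed

text \<open>\<open>Suc N\<close> recurs on the right because the largest index may repeat. This is
  the source of the factor 1/(1 - x z) where the strict recursion gives 1 + x z.\<close>

lemma trunc_t_star_snoc:
  "trunc_t_star (Suc N) (\<alpha> @ [a]) =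
     trunc_t_star N (\<alpha> @ [a]) + (1 / (2 * real N + 1)) ^ a * trunc_t_star (Suc N) \<alpha>"
proof -
  let ?A = "weak_lists N (Suc (length \<alpha>))"
  let ?B = "(\<lambda>j. j @ [Suc N]) ` weak_lists (Suc N) (length \<alpha>)"
  have disj: "?A \<inter> ?B = {}" by (auto simp: weak_lists_def)
  have "sum (t_term (\<alpha> @ [a])) ?B =
      (\<Sum>j\<in>weak_lists (Suc N) (length \<alpha>). t_term (\<alpha> @ [a]) (j @ [Suc N]))"
    by (subst sum.reindex) (auto simp: inj_on_def)
  also have "\<dots> = (\<Sum>j\<in>weak_lists (Suc N) (length \<alpha>). (1 / (2 * real N + 1)) ^ a * t_term \<alpha> j)"
    by (rule sum.cong) (auto simp: weak_lists_def t_term_snoc algebra_simps)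
  finally show ?thesis
    using sum.union_disjoint[OF finite_weak_lists finite_imageI[OF finite_weak_lists] disj,
        of "t_term (\<alpha> @ [a])"]
    by (simp add: trunc_t_star_def weak_lists_Suc sum_distrib_left)
qed

section \<open>Convergence of the truncations\<close>

lemma sum_odd_inverse_squares_le:
  "(\<Sum>i<N. (1 / (2 * real i + 1)) ^ 2) \<le> 2"
proof -
  \<comment> \<open>The sharper bound makes the induction close: its increment 2/((N+1)(N+2))
    dominates 1/(2N+1)^2.\<close>
  have "(\<Sum>i<N. (1 / (2 * real i + 1)) ^ 2) \<le> 2 - 2 / (real N + 1)"
  proof (induction N)
    case (Suc N)
    have "(1 / (2 * real N + 1)) ^ 2 \<le> 2 / (real N + 1) - 2 / (real N + 2)"
      by (simp add: divide_simps power2_eq_square) (simp add: algebra_simps)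
    then show ?case using Suc by (simp add: algebra_simps)
  qed simp
  also have "\<dots> \<le> 2" by simp
  finally show ?thesis .
qed

lemma odd_power_le_square:
  assumes "2 \<le> a"
  shows "(1 / (2 * real N + 1)) ^ a \<le> (1 / (2 * real N + 1)) ^ 2"
  using assms by (intro power_decreasing) auto

lemma trunc_t_nonneg: "0 \<le> trunc_t N \<alpha>"
  unfolding trunc_t_def by (rule sum_nonneg, rule t_term_nonneg) (auto simp: strict_lists_def)

lemma trunc_t_star_nonneg: "0 \<le> trunc_t_star N \<alpha>"
  unfolding trunc_t_star_def by (rule sum_nonneg, rule t_term_nonneg) (auto simp: weak_lists_def)

text \<open>Unrolling \<open>trunc_t_snoc\<close> over \<open>N\<close> shows that each exponent
  costs at most the sum of the odd inverse squares, hence a factor 2. What matters is uniformity in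
  \<open>N\<close>.\<close>

lemma trunc_t_bounded:
  assumes "\<forall>a\<in>set \<alpha>. 2 \<le> a"
  shows "trunc_t N \<alpha> \<le> 2 ^ length \<alpha>"
  using assms
proof (induction \<alpha> arbitrary: N rule: rev_induct)
  case (snoc a \<alpha>)
  have "trunc_t N (\<alpha> @ [a]) \<le> (\<Sum>i<N. (1 / (2 * real i + 1)) ^ 2) * 2 ^ length \<alpha>"
  proof (induction N)
    case (Suc N)
    have "(1 / (2 * real N + 1)) ^ a * trunc_t N \<alpha> \<le> (1 / (2 * real N + 1)) ^ 2 * 2 ^ length \<alpha>"
      using snoc by (intro mult_mono odd_power_le_square trunc_t_nonneg) auto
    then show ?case using Suc by (simp add: trunc_t_snoc distrib_right)
  qed (simp add: trunc_t_zero)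
  also have "\<dots> \<le> 2 * 2 ^ length \<alpha>"
    by (intro mult_right_mono sum_odd_inverse_squares_le) simp
  finally show ?case by simp
qed simp

lemma trunc_t_star_bounded:
  assumes "\<forall>a\<in>set \<alpha>. 2 \<le> a"
  shows "trunc_t_star N \<alpha> \<le> 2 ^ length \<alpha>"
  using assms
proof (induction \<alpha> arbitrary: N rule: rev_induct)
  case (snoc a \<alpha>)
  have "trunc_t_star N (\<alpha> @ [a]) \<le> (\<Sum>i<N. (1 / (2 * real i + 1)) ^ 2) * 2 ^ length \<alpha>"
  proof (induction N)
    case (Suc N)
    have "(1 / (2 * real N + 1)) ^ a * trunc_t_star (Suc N) \<alpha>
        \<le> (1 / (2 * real N + 1)) ^ 2 * 2 ^ length \<alpha>"
      using snoc by (intro mult_mono odd_power_le_square trunc_t_star_nonneg) auto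
    then show ?case using Suc by (simp add: trunc_t_star_snoc distrib_right)
  qed (simp add: trunc_t_star_zero)
  also have "\<dots> \<le> 2 * 2 ^ length \<alpha>"
    by (intro mult_right_mono sum_odd_inverse_squares_le) simp
  finally show ?case by simp
qed simp

text \<open>Links the truncations to unordered sums: boundedness and nonnegativity give summability,
  and the exhausting sets are cofinal among the finite subsets of \<open>A\<close>.\<close>

lemma exhaustion_sum_tendsto_infsum:
  fixes f :: "'a \<Rightarrow> real"
  assumes fin: "\<And>N. finite (B N)" and inc: "incseq B" and A: "A = (\<Union>N. B N)"
    and nonneg: "\<And>x. x \<in> A \<Longrightarrow> 0 \<le> f x" and bound: "\<And>N. sum f (B N) \<le> C"
  shows "(\<lambda>N. sum f (B N)) \<longlonglongrightarrow> infsum f A"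
proof -
  have cover: "\<exists>N. X \<subseteq> B N" if "finite X" "X \<subseteq> A" for X
    using that
  proof (induction X rule: finite_induct)
    case (insert x X)
    then obtain N M where "X \<subseteq> B N" "x \<in> B M" using A by auto
    then have "insert x X \<subseteq> B (max N M)"
      using incseqD[OF inc, of N "max N M"] incseqD[OF inc, of M "max N M"] by auto
    then show ?case by blast
  qed simp
  have "f summable_on A"
  proof (rule nonneg_bdd_above_summable_on)
    show "bdd_above (sum f ` {F. F \<subseteq> A \<and> finite F})"
    proof (rule bdd_aboveI2)
      fix F assume "F \<in> {F. F \<subseteq> A \<and> finite F}"
      then obtain N where N: "F \<subseteq> B N" using cover by blast
      have "sum f F \<le> sum f (B N)" using N fin A nonneg by (intro sum_mono2) auto
      then show "sum f F \<le> C" using bound[of N] by simp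
    qed
  qed (rule nonneg)
  then have lim: "(sum f \<longlongrightarrow> infsum f A) (finite_subsets_at_top A)"
    using has_sum_infsum has_sum_def by blast
  have "filterlim B (finite_subsets_at_top A) sequentially"
    unfolding filterlim_finite_subsets_at_top
  proof (intro allI impI)
    fix X assume "finite X \<and> X \<subseteq> A"
    then obtain M where M: "X \<subseteq> B M" using cover by blast
    show "\<forall>\<^sub>F N in sequentially. finite (B N) \<and> X \<subseteq> B N \<and> B N \<subseteq> A"
      using eventually_ge_at_top[of M] by eventually_elim (use fin A M incseqD[OF inc] in blast)
  qed
  from filterlim_compose[OF lim this] show ?thesis .
qed

lemma trunc_t_tendsto:
  assumes "\<forall>a\<in>set \<alpha>. 2 \<le> a"
  shows "(\<lambda>N. trunc_t N \<alpha>) \<longlonglongrightarrow> mult_t \<alpha>"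
proof -
  let ?A = "{j :: nat list. length j = length \<alpha> \<and> (\<forall>x\<in>set j. 1 \<le> x) \<and> sorted_wrt (<) j}"
  have A: "?A = (\<Union>N. strict_lists N (length \<alpha>))"
  proof (intro set_eqI iffI)
    fix j assume "j \<in> ?A"
    \<comment> \<open>The sum of the entries serves as an upper bound for each of them.\<close>
    then have "j \<in> strict_lists (sum_list j) (length \<alpha>)"
      by (auto simp: strict_lists_def member_le_sum_list)
    then show "j \<in> (\<Union>N. strict_lists N (length \<alpha>))" by blast
  qed (auto simp: strict_lists_def)
  have "(\<lambda>N. sum (t_term \<alpha>) (strict_lists N (length \<alpha>))) \<longlonglongrightarrow> infsum (t_term \<alpha>) ?A"
  proof (rule exhaustion_sum_tendsto_infsum[OF finite_strict_lists _ A])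
    show "incseq (\<lambda>N. strict_lists N (length \<alpha>))"
      by (auto simp: incseq_def strict_lists_def intro: order_trans)
    show "sum (t_term \<alpha>) (strict_lists N (length \<alpha>)) \<le> 2 ^ length \<alpha>" for N
      using trunc_t_bounded[OF assms] by (simp add: trunc_t_def)
  qed (auto intro: t_term_nonneg)
  then show ?thesis by (simp add: trunc_t_def mult_t_def t_term_def[abs_def])
qed

lemma trunc_t_star_tendsto:
  assumes "\<forall>a\<in>set \<alpha>. 2 \<le> a"
  shows "(\<lambda>N. trunc_t_star N \<alpha>) \<longlonglongrightarrow> mult_t_star \<alpha>"
proof -
  let ?A = "{j :: nat list. length j = length \<alpha> \<and> (\<forall>x\<in>set j. 1 \<le> x) \<and> sorted_wrt (\<le>) j}"
  have A: "?A = (\<Union>N. weak_lists N (length \<alpha>))"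
  proof (intro set_eqI iffI)
    fix j assume "j \<in> ?A"
    then have "j \<in> weak_lists (sum_list j) (length \<alpha>)"
      by (auto simp: weak_lists_def member_le_sum_list)
    then show "j \<in> (\<Union>N. weak_lists N (length \<alpha>))" by blast
  qed (auto simp: weak_lists_def)
  have "(\<lambda>N. sum (t_term \<alpha>) (weak_lists N (length \<alpha>))) \<longlonglongrightarrow> infsum (t_term \<alpha>) ?A"
  proof (rule exhaustion_sum_tendsto_infsum[OF finite_weak_lists _ A])
    show "incseq (\<lambda>N. weak_lists N (length \<alpha>))"
      by (auto simp: incseq_def weak_lists_def intro: order_trans)
    show "sum (t_term \<alpha>) (weak_lists N (length \<alpha>)) \<le> 2 ^ length \<alpha>" for N
      using trunc_t_star_bounded[OF assms] by (simp add: trunc_t_star_def)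
  qed (auto intro: t_term_nonneg)
  then show ?thesis by (simp add: trunc_t_star_def mult_t_star_def t_term_def[abs_def])
qed

section \<open>Recursions for sums over compositions\<close>

text \<open>The common shape of \<open>T_sum\<close>, \<open>T_star_sum\<close> and their
  truncations, with the summand \<open>f\<close> left open so that one recursion serves both
  kinds.\<close>

definition comp_sum :: "(nat list \<Rightarrow> real) \<Rightarrow> nat \<Rightarrow> nat \<Rightarrow> nat \<Rightarrow> real" where
  "comp_sum f m n k = (\<Sum>\<alpha>\<in>pos_tuples n k. f (map (\<lambda>a. m * a) \<alpha>))"

lemma finite_pos_tuples: "finite (pos_tuples n k)"
  by (rule finite_subset[OF _ finite_lists_length_eq[of "{..n}" k]])
    (auto simp: pos_tuples_def member_le_sum_list)

lemma pos_tuples_0: "pos_tuples n 0 = (if n = 0 then {[]} else {})"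
  by (auto simp: pos_tuples_def)

lemma length_le_sum_list:
  fixes \<alpha> :: "nat list"
  assumes "\<forall>a\<in>set \<alpha>. 1 \<le> a"
  shows "length \<alpha> \<le> sum_list \<alpha>"
  using assms by (induction \<alpha>) auto

lemma pos_tuples_empty: "n < k \<Longrightarrow> pos_tuples n k = {}"
  using length_le_sum_list by (fastforce simp: pos_tuples_def)

text \<open>Either the last part is 1 and is dropped, or it is larger and is decreased by 1.\<close>

lemma pos_tuples_Suc_Suc:
  "pos_tuples (Suc n) (Suc k) =
     (\<lambda>\<beta>. \<beta> @ [1]) ` pos_tuples n k \<union>
     (\<lambda>\<beta>. butlast \<beta> @ [Suc (last \<beta>)]) ` pos_tuples n (Suc k)"
proof (intro set_eqI iffI)
  fix \<alpha> assume \<alpha>: "\<alpha> \<in> pos_tuples (Suc n) (Suc k)"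
  then obtain \<beta> a where \<beta>: "\<alpha> = \<beta> @ [a]"
    by (cases \<alpha> rule: rev_cases) (auto simp: pos_tuples_def)
  show "\<alpha> \<in> (\<lambda>\<beta>. \<beta> @ [1]) ` pos_tuples n k \<union>
     (\<lambda>\<beta>. butlast \<beta> @ [Suc (last \<beta>)]) ` pos_tuples n (Suc k)"
  proof (cases "a = 1")
    case True
    then show ?thesis using \<alpha> \<beta> by (auto simp: pos_tuples_def)
  next
    case False
    then have "\<beta> @ [a - 1] \<in> pos_tuples n (Suc k)" "\<alpha> = butlast (\<beta> @ [a - 1]) @ [Suc (last (\<beta> @ [a - 1]))]"
      using \<alpha> \<beta> by (auto simp: pos_tuples_def)
    then show ?thesis by blast
  qed
next
  fix \<alpha> assume "\<alpha> \<in> (\<lambda>\<beta>. \<beta> @ [1]) ` pos_tuples n k \<union>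
     (\<lambda>\<beta>. butlast \<beta> @ [Suc (last \<beta>)]) ` pos_tuples n (Suc k)"
  then show "\<alpha> \<in> pos_tuples (Suc n) (Suc k)"
  proof
    assume "\<alpha> \<in> (\<lambda>\<beta>. butlast \<beta> @ [Suc (last \<beta>)]) ` pos_tuples n (Suc k)"
    then obtain \<beta> where \<beta>: "\<beta> \<in> pos_tuples n (Suc k)" "\<alpha> = butlast \<beta> @ [Suc (last \<beta>)]" by blast
    obtain \<gamma> a where "\<beta> = \<gamma> @ [a]"
      using \<beta>(1) by (cases \<beta> rule: rev_cases) (auto simp: pos_tuples_def)
    then show ?thesis using \<beta> by (auto simp: pos_tuples_def)
  qed (auto simp: pos_tuples_def)
qed

lemma comp_sum_Suc_Suc:
  "comp_sum f m (Suc n) (Suc k) =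
     (\<Sum>\<beta>\<in>pos_tuples n k. f (map (\<lambda>a. m * a) \<beta> @ [m])) +
     (\<Sum>\<beta>\<in>pos_tuples n (Suc k).
        f (map (\<lambda>a. m * a) (butlast \<beta>) @ [m * Suc (last \<beta>)]))"
proof -
  let ?h = "\<lambda>\<beta>. butlast \<beta> @ [Suc (last \<beta>)]"
  have ne: "\<beta> \<noteq> []" if "\<beta> \<in> pos_tuples n (Suc k)" for \<beta>
    using that by (auto simp: pos_tuples_def)
  have inj: "inj_on ?h (pos_tuples n (Suc k))"
    by (rule inj_onI) (metis append1_eq_conv append_butlast_last_id ne nat.inject)
  \<comment> \<open>The last part is 1 in the first image and at least 2 in the second.\<close>
  have disj: "(\<lambda>\<beta>. \<beta> @ [1]) ` pos_tuples n k \<inter> ?h ` pos_tuples n (Suc k) = {}"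
  proof -
    have "last \<beta> \<noteq> 0" if "\<beta> \<in> pos_tuples n (Suc k)" for \<beta>
      using that last_in_set[OF ne[OF that]] by (auto simp: pos_tuples_def)
    then show ?thesis by fastforce
  qed
  show ?thesis
    unfolding comp_sum_def pos_tuples_Suc_Suc
    by (subst sum.union_disjoint[OF finite_imageI[OF finite_pos_tuples]
          finite_imageI[OF finite_pos_tuples] disj])
      (simp add: sum.reindex inj inj_on_def[of "\<lambda>\<beta>. \<beta> @ [Suc 0]"])
qed

text \<open>
  Subtracting \<open>w ^ m\<close> times the value at \<open>n\<close>, i.e. multiplying the generating function by
  \<open>1 - w\<^sup>m z\<close>, collapses the sum over the last part of the composition to the term with last part 1.
\<close>

lemma comp_sum_diff:
  assumes "\<And>\<alpha> a. f (\<alpha> @ [a]) = g (\<alpha> @ [a]) + w ^ a * h \<alpha>"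
  shows "comp_sum f m (Suc n) (Suc k) - w ^ m * comp_sum f m n (Suc k) =
    comp_sum g m (Suc n) (Suc k) - w ^ m * comp_sum g m n (Suc k) + w ^ m * comp_sum h m n k"
proof -
  have fm: "f (map (\<lambda>a. m * a) \<beta>) = g (map (\<lambda>a. m * a) \<beta>) +
      w ^ (m * last \<beta>) * h (map (\<lambda>a. m * a) (butlast \<beta>))"
    if \<beta>: "\<beta> \<in> pos_tuples n (Suc k)" for \<beta>
  proof -
    obtain \<gamma> a where "\<beta> = \<gamma> @ [a]"
      using \<beta> by (cases \<beta> rule: rev_cases) (auto simp: pos_tuples_def)
    then show ?thesis by (simp add: assms)
  qed
  have "comp_sum f m n (Suc k) = comp_sum g m n (Suc k) +
      (\<Sum>\<beta>\<in>pos_tuples n (Suc k). w ^ (m * last \<beta>) * h (map (\<lambda>a. m * a) (butlast \<beta>)))"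
    by (simp add: comp_sum_def fm sum.distrib)
  \<comment> \<open>A last part raised by 1 contributes \<open>w ^ m\<close> times its old power of
    \<open>w\<close>, so these terms cancel against the subtracted sum.\<close>
  then show ?thesis
    by (simp add: comp_sum_Suc_Suc assms sum.distrib power_add sum_distrib_left algebra_simps
        comp_sum_def[of h])
qed

lemma comp_sum_gt: "n < k \<Longrightarrow> comp_sum f m n k = 0"
  by (simp add: comp_sum_def pos_tuples_empty)

lemma comp_sum_0: "comp_sum f m n 0 = (if n = 0 then f [] else 0)"
  by (simp add: comp_sum_def pos_tuples_0)

section \<open>Generating functions\<close>

text \<open>Power series in \<open>z\<close> whose coefficients are polynomials in a variable \<open>y\<close> marking the depth.\<close>

definition comp_fps :: "(nat list \<Rightarrow> real) \<Rightarrow> nat \<Rightarrow> real poly fps" where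
  "comp_fps f m = Abs_fps (\<lambda>n. \<Sum>k\<le>n. monom (comp_sum f m n k) k)"

text \<open>With \<open>trunc_t N\<close> for \<open>f\<close> this is the truncated E(uz), with
  \<open>trunc_t_star N\<close> the truncated H(uz).\<close>

definition weighted_fps :: "(nat list \<Rightarrow> real) \<Rightarrow> nat \<Rightarrow> real poly \<Rightarrow> real poly fps" where
  "weighted_fps f m u = Abs_fps (\<lambda>p. smult (f (replicate p m)) (u ^ p))"

text \<open>Valid also for k > n, since no composition of n has more than n parts.\<close>

lemma coeff_comp_fps: "coeff (fps_nth (comp_fps f m) n) k = comp_sum f m n k"
proof -
  have "coeff (fps_nth (comp_fps f m) n) k =
      (\<Sum>i\<le>n. if i = k then comp_sum f m n i else 0)"
    by (simp add: comp_fps_def coeff_sum)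
  also have "\<dots> = comp_sum f m n k"
    by (cases "k \<le> n") (simp_all add: comp_sum_gt)
  finally show ?thesis .
qed

section \<open>The factor gained by adjoining one index\<close>

lemma fps_one_minus_nth:
  fixes F :: "'a::comm_ring_1 fps"
  shows "fps_nth (F * (1 - fps_const c * fps_X)) n =
    (case n of 0 \<Rightarrow> fps_nth F 0 | Suc i \<Rightarrow> fps_nth F (Suc i) - c * fps_nth F i)"
proof -
  have "F * (1 - fps_const c * fps_X) = F - fps_const c * (fps_X * F)"
    by (simp add: algebra_simps)
  then show ?thesis by (simp split: nat.split)
qed

text \<open>With x = \<open>w ^ m\<close>, the new factor is 1 + yxz/(1 - xz) = (1 - (1 - y)xz)/(1 -
  xz), stated with the denominator cleared.\<close>

lemma comp_fps_step_strict:
  assumes "\<And>\<alpha> a. f (\<alpha> @ [a]) = g (\<alpha> @ [a]) + w ^ a * g \<alpha>" and "f [] = g []"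
  shows "comp_fps f m * (1 - fps_const [:w ^ m:] * fps_X) =
    comp_fps g m * (1 - fps_const [:w ^ m, - (w ^ m):] * fps_X)"
proof (rule fps_ext, rule poly_eqI)
  fix n k
  show "coeff (fps_nth (comp_fps f m * (1 - fps_const [:w ^ m:] * fps_X)) n) k =
    coeff (fps_nth (comp_fps g m * (1 - fps_const [:w ^ m, - (w ^ m):] * fps_X)) n) k"
    using comp_sum_diff[where f = f and g = g and h = g and w = w, OF assms(1)] assms(2)
    by (cases n; cases k)
      (simp_all add: fps_one_minus_nth coeff_comp_fps comp_sum_0 comp_sum_gt algebra_simps)
qed

text \<open>The new factor is 1/(1 - yxz/(1 - xz)) = (1 - xz)/(1 - (1 + y)xz), again with the
  denominator cleared.\<close>

lemma comp_fps_step_weak: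
  assumes "\<And>\<alpha> a. f (\<alpha> @ [a]) = g (\<alpha> @ [a]) + w ^ a * f \<alpha>" and "f [] = g []"
  shows "comp_fps f m * (1 - fps_const [:w ^ m, w ^ m:] * fps_X) =
    comp_fps g m * (1 - fps_const [:w ^ m:] * fps_X)"
proof (rule fps_ext, rule poly_eqI)
  fix n k
  show "coeff (fps_nth (comp_fps f m * (1 - fps_const [:w ^ m, w ^ m:] * fps_X)) n) k =
    coeff (fps_nth (comp_fps g m * (1 - fps_const [:w ^ m:] * fps_X)) n) k"
    using comp_sum_diff[where f = f and g = g and h = f and w = w, OF assms(1)] assms(2)
    by (cases n; cases k)
      (simp_all add: fps_one_minus_nth coeff_comp_fps comp_sum_0 comp_sum_gt algebra_simps)
qed

lemma weighted_fps_step_strict: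
  assumes "\<And>\<alpha> a. f (\<alpha> @ [a]) = g (\<alpha> @ [a]) + w ^ a * g \<alpha>" and "f [] = g []"
  shows "weighted_fps f m u = weighted_fps g m u * (1 - fps_const (smult (- (w ^ m)) u) * fps_X)"
proof (rule fps_ext)
  fix n
  have "f (replicate (Suc i) m) = g (replicate (Suc i) m) + w ^ m * g (replicate i m)" for i
    using assms(1)[of "replicate i m" m] by (simp add: replicate_append_same)
  then show "fps_nth (weighted_fps f m u) n =
      fps_nth (weighted_fps g m u * (1 - fps_const (smult (- (w ^ m)) u) * fps_X)) n"
    using assms(2)
    by (simp add: fps_one_minus_nth weighted_fps_def smult_add_left del: replicate_Suc
        split: nat.split) (simp add: mult.commute)
qed

lemma weighted_fps_step_weak:
  assumes "\<And>\<alpha> a. f (\<alpha> @ [a]) = g (\<alpha> @ [a]) + w ^ a * f \<alpha>" and "f [] = g []"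
  shows "weighted_fps f m u * (1 - fps_const (smult (w ^ m) u) * fps_X) = weighted_fps g m u"
proof (rule fps_ext)
  fix n
  have "f (replicate (Suc i) m) = g (replicate (Suc i) m) + w ^ m * f (replicate i m)" for i
    using assms(1)[of "replicate i m" m] by (simp add: replicate_append_same)
  then show "fps_nth (weighted_fps f m u * (1 - fps_const (smult (w ^ m) u) * fps_X)) n =
      fps_nth (weighted_fps g m u) n"
    using assms(2)
    by (simp add: fps_one_minus_nth weighted_fps_def smult_add_left del: replicate_Suc
        split: nat.split) (simp add: mult.commute)
qed

text \<open>The constant coefficient is 1. This permits cancelling the cleared denominators in the
  integral domain \<open>real poly fps\<close>.\<close>

lemma one_minus_fps_X_nonzero:
  "1 - fps_const (c :: 'a::comm_ring_1) * fps_X \<noteq> 0"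
proof
  assume "1 - fps_const c * fps_X = 0"
  then have "fps_nth (1 - fps_const c * fps_X) 0 = 0" by simp
  then show False by simp
qed

section \<open>Product formulas for the truncated generating functions\<close>

lemma comp_fps_zero:
  assumes "\<And>\<alpha>. \<alpha> \<noteq> [] \<Longrightarrow> f \<alpha> = 0" and "f [] = 1"
  shows "comp_fps f m = 1"
proof (rule fps_ext, rule poly_eqI)
  fix n k
  have "comp_sum f m n (Suc i) = 0" for i
    unfolding comp_sum_def by (rule sum.neutral) (auto simp: pos_tuples_def intro!: assms(1))
  then show "coeff (fps_nth (comp_fps f m) n) k = coeff (fps_nth 1 n) k"
    using assms(2) by (cases k) (auto simp: coeff_comp_fps comp_sum_0)
qed

lemma weighted_fps_zero:
  assumes "\<And>\<alpha>. \<alpha> \<noteq> [] \<Longrightarrow> f \<alpha> = 0" and "f [] = 1"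
  shows "weighted_fps f m u = 1"
  by (rule fps_ext) (auto simp: weighted_fps_def assms)

text \<open>The truncated form of E((y - 1)z) H(z), as \<open>[:-1, 1:]\<close> is y - 1. Passing
  from \<open>N\<close> to \<open>Suc N\<close>, both sides gain the same factor.\<close>

lemma comp_fps_trunc_t:
  "comp_fps (trunc_t N) m =
     weighted_fps (trunc_t N) m [:-1, 1:] * weighted_fps (trunc_t_star N) m 1"
proof (induction N)
  case 0
  show ?case
    by (simp add: comp_fps_zero weighted_fps_zero trunc_t_zero trunc_t_star_zero)
next
  case (Suc N)
  define x where "x = (1 / (2 * real N + 1)) ^ m"
  let ?D = "1 - fps_const [:x:] * fps_X :: real poly fps"
  have F: "comp_fps (trunc_t (Suc N)) m * ?D =
      comp_fps (trunc_t N) m * (1 - fps_const [:x, -x:] * fps_X)"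
    unfolding x_def by (rule comp_fps_step_strict) (simp_all add: trunc_t_snoc)
  have E: "weighted_fps (trunc_t (Suc N)) m [:-1, 1:] =
      weighted_fps (trunc_t N) m [:-1, 1:] * (1 - fps_const [:x, -x:] * fps_X)"
    using weighted_fps_step_strict[where f = "trunc_t (Suc N)" and g = "trunc_t N" and
        u = "[:-1, 1:]" and m = m and w = "1 / (2 * real N + 1)", OF trunc_t_snoc]
    by (simp add: x_def)
  have H: "weighted_fps (trunc_t_star (Suc N)) m 1 * ?D = weighted_fps (trunc_t_star N) m 1"
    using weighted_fps_step_weak[where f = "trunc_t_star (Suc N)" and g = "trunc_t_star N" and
        u = 1 and m = m and w = "1 / (2 * real N + 1)", OF trunc_t_star_snoc]
    by (simp add: x_def one_pCons)
  \<comment> \<open>On the right \<open>?D\<close> is absorbed by the star series, while the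
    numerator of the new factor goes to the strict series.\<close>
  have "comp_fps (trunc_t (Suc N)) m * ?D =
     (weighted_fps (trunc_t (Suc N)) m [:-1, 1:] * weighted_fps (trunc_t_star (Suc N)) m 1) * ?D"
    unfolding F Suc.IH E H[symmetric] by (simp only: mult_ac)
  then show ?case using one_minus_fps_X_nonzero by (simp only: mult_cancel_right) blast
qed

text \<open>The truncated form of E(-z) H((1 + y)z). Here the strict series takes the numerator 1 -
  xz and the star series the denominator \<open>?D\<close>.\<close>

lemma comp_fps_trunc_t_star:
  "comp_fps (trunc_t_star N) m =
     weighted_fps (trunc_t N) m (-1) * weighted_fps (trunc_t_star N) m [:1, 1:]"
proof (induction N)
  case 0
  show ?case
    by (simp add: comp_fps_zero weighted_fps_zero trunc_t_zero trunc_t_star_zero)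
next
  case (Suc N)
  define x where "x = (1 / (2 * real N + 1)) ^ m"
  let ?D = "1 - fps_const [:x, x:] * fps_X :: real poly fps"
  have F: "comp_fps (trunc_t_star (Suc N)) m * ?D =
      comp_fps (trunc_t_star N) m * (1 - fps_const [:x:] * fps_X)"
    unfolding x_def by (rule comp_fps_step_weak) (simp_all add: trunc_t_star_snoc)
  have E: "weighted_fps (trunc_t (Suc N)) m (-1) =
      weighted_fps (trunc_t N) m (-1) * (1 - fps_const [:x:] * fps_X)"
    using weighted_fps_step_strict[where f = "trunc_t (Suc N)" and g = "trunc_t N" and
        u = "-1" and m = m and w = "1 / (2 * real N + 1)", OF trunc_t_snoc]
    by (simp add: x_def one_pCons)
  have H: "weighted_fps (trunc_t_star (Suc N)) m [:1, 1:] * ?D =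
      weighted_fps (trunc_t_star N) m [:1, 1:]"
    using weighted_fps_step_weak[where f = "trunc_t_star (Suc N)" and g = "trunc_t_star N" and
        u = "[:1, 1:]" and m = m and w = "1 / (2 * real N + 1)", OF trunc_t_star_snoc]
    by (simp add: x_def)
  have "comp_fps (trunc_t_star (Suc N)) m * ?D =
     (weighted_fps (trunc_t (Suc N)) m (-1) * weighted_fps (trunc_t_star (Suc N)) m [:1, 1:]) * ?D"
    unfolding F Suc.IH E H[symmetric] by (simp only: mult_ac)
  then show ?case using one_minus_fps_X_nonzero by (simp only: mult_cancel_right) blast
qed

section \<open>Comparison of coefficients and passage to the limit\<close>

lemma coeff_linear_power_gt:
  fixes c :: "'a::comm_ring_1"
  assumes "p < k"
  shows "coeff ([:c, 1:] ^ p) k = 0"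
  using assms degree_power_le[of "[:c, 1:]" p] by (intro coeff_eq_0) (simp split: if_splits)

text \<open>The coefficient of y^k in (y - 1)^p supplies the sign and the binomial coefficient; it
  vanishes for p < k, so the convolution starts at p = k.\<close>

lemma trunc_T:
  "comp_sum (trunc_t N) m n k =
     (\<Sum>p=k..n. (-1) ^ (p - k) * real (p choose k)
        * trunc_t N (replicate p m) * trunc_t_star N (replicate (n - p) m))"
proof -
  have "comp_sum (trunc_t N) m n k = coeff (fps_nth (comp_fps (trunc_t N) m) n) k"
    by (simp add: coeff_comp_fps)
  also have "\<dots> = (\<Sum>p=0..n. coeff ([:-1, 1:] ^ p) k
        * trunc_t N (replicate p m) * trunc_t_star N (replicate (n - p) m))"
    unfolding comp_fps_trunc_t fps_mult_nth coeff_sum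
    by (rule sum.cong) (simp_all add: weighted_fps_def mult_ac)
  also have "\<dots> = (\<Sum>p=k..n. coeff ([:-1, 1:] ^ p) k
        * trunc_t N (replicate p m) * trunc_t_star N (replicate (n - p) m))"
    by (rule sum.mono_neutral_right) (auto simp: coeff_linear_power_gt)
  also have "\<dots> = (\<Sum>p=k..n. (-1) ^ (p - k) * real (p choose k)
        * trunc_t N (replicate p m) * trunc_t_star N (replicate (n - p) m))"
    by (rule sum.cong) (auto simp: coeff_linear_poly_power mult_ac)
  finally show ?thesis .
qed

lemma trunc_T_star:
  "comp_sum (trunc_t_star N) m n k =
     (\<Sum>q=k..n. (-1) ^ (n + q) * real (q choose k)
        * trunc_t N (replicate (n - q) m) * trunc_t_star N (replicate q m))"
proof -
  have sgn: "(- 1 :: real poly) ^ i = [:(-1) ^ i:]" for i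
    by (induction i) (simp_all add: one_pCons)
  have "comp_sum (trunc_t_star N) m n k = coeff (fps_nth (comp_fps (trunc_t_star N) m) n) k"
    by (simp add: coeff_comp_fps)
  \<comment> \<open>The factors are commuted so that the convolution index \<open>q\<close> counts
    the depth of the star value; the sign comes from E(-z).\<close>
  also have "\<dots> = (\<Sum>q=0..n. coeff ([:1, 1:] ^ q) k * (-1) ^ (n - q)
        * trunc_t N (replicate (n - q) m) * trunc_t_star N (replicate q m))"
    unfolding comp_fps_trunc_t_star mult.commute[of "weighted_fps (trunc_t N) m (-1)"]
      fps_mult_nth coeff_sum
    by (rule sum.cong) (simp_all add: weighted_fps_def sgn mult_ac)
  also have "\<dots> = (\<Sum>q=k..n. coeff ([:1, 1:] ^ q) k * (-1) ^ (n - q)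
        * trunc_t N (replicate (n - q) m) * trunc_t_star N (replicate q m))"
    by (rule sum.mono_neutral_right) (auto simp: coeff_linear_power_gt)
  also have "\<dots> = (\<Sum>q=k..n. (-1) ^ (n + q) * real (q choose k)
        * trunc_t N (replicate (n - q) m) * trunc_t_star N (replicate q m))"
    \<comment> \<open>For q at most n, the numbers n - q and n + q have the same parity.\<close>
    by (rule sum.cong) (auto simp: coeff_linear_poly_power minus_one_power_iff mult_ac)
  finally show ?thesis .
qed

theorem theorem1:
  fixes k n m :: nat
  assumes "1 \<le> k" and "k \<le> n" and "2 \<le> m"
  shows "T_sum m n k =
           (\<Sum>p=k..n. (-1) ^ (p - k) * real (p choose k)
              * mult_t (replicate p m) * mult_t_star (replicate (n - p) m))
       \<and> T_star_sum m n k =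
           (\<Sum>q=k..n. (-1) ^ (n + q) * real (q choose k)
              * mult_t (replicate (n - q) m) * mult_t_star (replicate q m))"
proof -
  \<comment> \<open>Exponents of at least 2 secure convergence of the truncations. Both sides of
    each finite identity then have limits, which agree by uniqueness.\<close>
  have ge: "\<forall>b\<in>set (map (\<lambda>a. m * a) \<alpha>). 2 \<le> b" if "\<alpha> \<in> pos_tuples n k" for \<alpha>
  proof -
    have "2 * 1 \<le> m * a" if "a \<in> set \<alpha>" for a
      using that \<open>\<alpha> \<in> pos_tuples n k\<close> assms(3) by (intro mult_le_mono) (auto simp: pos_tuples_def)
    then show ?thesis by auto
  qed
  have rep: "\<forall>b\<in>set (replicate p m). 2 \<le> b" for p
    using assms(3) by simp
  have "(\<lambda>N. comp_sum (trunc_t N) m n k) \<longlonglongrightarrow> T_sum m n k"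
    unfolding comp_sum_def T_sum_def by (intro tendsto_sum trunc_t_tendsto ge)
  moreover have "(\<lambda>N. comp_sum (trunc_t N) m n k) \<longlonglongrightarrow>
      (\<Sum>p=k..n. (-1) ^ (p - k) * real (p choose k)
         * mult_t (replicate p m) * mult_t_star (replicate (n - p) m))"
    unfolding trunc_T
    by (intro tendsto_intros trunc_t_tendsto trunc_t_star_tendsto rep)
  moreover have "(\<lambda>N. comp_sum (trunc_t_star N) m n k) \<longlonglongrightarrow> T_star_sum m n k"
    unfolding comp_sum_def T_star_sum_def by (intro tendsto_sum trunc_t_star_tendsto ge)
  moreover have "(\<lambda>N. comp_sum (trunc_t_star N) m n k) \<longlonglongrightarrow>
      (\<Sum>q=k..n. (-1) ^ (n + q) * real (q choose k)
         * mult_t (replicate (n - q) m) * mult_t_star (replicate q m))"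
    unfolding trunc_T_star
    by (intro tendsto_intros trunc_t_tendsto trunc_t_star_tendsto rep)
  ultimately show ?thesis by (blast intro: LIMSEQ_unique)
qed

end
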